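(* Consider the following two-player game on the board $\mathbb{Z}^{2}$, with a real parameter $\sigma>0$. The devil controls a weight function (measure) $\mu_t$ on $\mathbb{Z}^2$, with $\mu_0=0$; at each of his turns he may add nonnegative weight to squares, arbitrarily distributed, subject to $\mu_{t+1}\ge \mu_t$ and $\mu_{t+1}(\mathbb{Z}^{2})\le\mu_{t}(\mathbb{Z}^{2})+\sigma$. The angel occupies a square of $\mathbb{Z}^2$; the players alternate turns, and on each of her turns the angel makes at most one step, horizontal or vertical (to an adjacent square). The angel is not allowed to step on a square whose weight is $\ge 1$. Then for all sufficiently small $\sigma>0$, the angel has a strategy in which she will never run out of places to land on, i.e. whatever the devil does, she can continue moving forever without ever stepping on a square of weight $\ge 1$.
   Context: For a set $S\subseteq\mathbb{Z}^2$, $\mu_t(S)$ denotes the total weight of $S$ at time $t$. This weighted game is a strengthening (for the devil) of the classical angel–devil game in which the angel can fly distance $J$ and the devil blackens one square per turn, with $\sigma=1/J$. *)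

theory Defs
  imports "HOL-Analysis.Infinite_Sum"
begin

type_synonym square = "int \<times> int"
type_synonym weighting = "square \<Rightarrow> real"

definition total_weight :: "weighting \<Rightarrow> square set \<Rightarrow> real" where
  "total_weight \<mu> S = (\<Sum>\<^sub>\<infinity>x\<in>S. \<mu> x)"

(* Infinitely many squares may receive weight in one turn. Summability is required because
   infsum is 0 on families that are not summable. *)
definition devil_move :: "real \<Rightarrow> weighting \<Rightarrow> weighting \<Rightarrow> bool" where
  "devil_move \<sigma> \<mu> \<mu>' \<longleftrightarrow>
     (\<forall>x. \<mu> x \<le> \<mu>' x) \<and> \<mu>' summable_on UNIV \<and>
     total_weight \<mu>' UNIV \<le> total_weight \<mu> UNIV + \<sigma>"

definition devil_play :: "real \<Rightarrow> (nat \<Rightarrow> weighting) \<Rightarrow> bool" where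
  "devil_play \<sigma> \<mu> \<longleftrightarrow> \<mu> 0 = (\<lambda>x. 0) \<and> (\<forall>t. devil_move \<sigma> (\<mu> t) (\<mu> (Suc t)))"

definition adjacent :: "square \<Rightarrow> square \<Rightarrow> bool" where
  "adjacent p q \<longleftrightarrow> \<bar>fst p - fst q\<bar> + \<bar>snd p - snd q\<bar> = 1"

(* The angel may stay where she is only if that square still has weight below 1; otherwise
   she could sit forever on a square of weight at least 1. She may be standing on a square
   that has just reached weight 1, but must then leave it in this turn. *)
definition angel_move :: "weighting \<Rightarrow> square \<Rightarrow> square \<Rightarrow> bool" where
  "angel_move \<mu> p q \<longleftrightarrow> (q = p \<or> adjacent p q) \<and> \<mu> q < 1"

(* A strategy gives the next square from the weight functions up to and including the
   current one. The angel's own earlier positions are determined by these and the starting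
   square, so they need not be arguments. *)
type_synonym strategy = "weighting list \<Rightarrow> square"

(* In round t the devil moves first, from \<mu> t to \<mu> (Suc t), and then the angel replies. *)
primrec angel_pos :: "square \<Rightarrow> strategy \<Rightarrow> (nat \<Rightarrow> weighting) \<Rightarrow> nat \<Rightarrow> square" where
  "angel_pos p s \<mu> 0 = p"
| "angel_pos p s \<mu> (Suc t) = s (map \<mu> [0..<Suc (Suc t)])"

definition winning_strategy :: "real \<Rightarrow> square \<Rightarrow> strategy \<Rightarrow> bool" where
  "winning_strategy \<sigma> p s \<longleftrightarrow>
     (\<forall>\<mu>. devil_play \<sigma> \<mu> \<longrightarrow>
        (\<forall>t. angel_move (\<mu> (Suc t)) (angel_pos p s \<mu> t) (angel_pos p s \<mu> (Suc t))))"

end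

theory Submission
  imports Defs
begin

text \<open>
  This is Mathe's argument for the angel of power two, adapted to weights. If the angel cannot
  survive, then the devil wins within a bounded number of rounds, because she has finitely many
  replies. Let his winning strategy react not to the actual path of the angel but to the shortcut
  path, in which each position is preceded by the earliest position from which it was within
  reach. Counting only the weight a square has received when it first comes within reach, the
  obstacles become static, yet the angel's shortcut path remains a legal play against the winning
  strategy; hence she stays within bounded distance of the start.

  However, let her declare the half plane to the west an additional wall and follow it northwards
  by the left-hand rule. No state repeats before the initial one, so every heavy square causes only
  boundedly many steps that do not lead north. As there are at most \<open>\<sigma> (m + 1)\<close> heavy
  squares within reach up to time \<open>m\<close>, she gets farther than \<open>m / 2\<close> to the north,
  and in particular she never returns to the initial state.
\<close>

section \<open>Finite-rank determinacy\<close>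

definition near :: "square \<Rightarrow> square \<Rightarrow> bool" where
  "near p q \<longleftrightarrow> \<bar>fst p - fst q\<bar> + \<bar>snd p - snd q\<bar> \<le> 1"

lemma near_refl [simp]: "near p p"
  by (simp add: near_def)

lemma angel_move_iff: "angel_move \<mu> p q \<longleftrightarrow> near p q \<and> \<mu> q < 1"
proof -
  have "q = p \<or> adjacent p q \<longleftrightarrow> near p q"
    by (cases p; cases q) (auto simp: near_def adjacent_def)
  then show ?thesis
    by (simp add: angel_move_def)
qed

lemma finite_near: "finite {q. near p q}"
proof (rule finite_subset)
  show "{q. near p q} \<subseteq> {fst p - 1..fst p + 1} \<times> {snd p - 1..snd p + 1}"
    by (auto simp: near_def)
qed simp

text \<open>Rank 0 is never a win: the devil wins by leaving the angel no legal reply, the vacuous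
  case of the second clause.\<close>

primrec devil_wins_within :: "real \<Rightarrow> nat \<Rightarrow> weighting \<Rightarrow> square \<Rightarrow> bool" where
  "devil_wins_within \<sigma> 0 \<mu> q \<longleftrightarrow> False"
| "devil_wins_within \<sigma> (Suc n) \<mu> q \<longleftrightarrow>
     (\<exists>\<mu>'. devil_move \<sigma> \<mu> \<mu>' \<and> (\<forall>q'. angel_move \<mu>' q q' \<longrightarrow> devil_wins_within \<sigma> n \<mu>' q'))"

lemma devil_wins_within_Suc:
  "devil_wins_within \<sigma> n \<mu> q \<Longrightarrow> devil_wins_within \<sigma> (Suc n) \<mu> q"
proof (induction n arbitrary: \<mu> q)
  case (Suc n)
  then obtain \<mu>' where "devil_move \<sigma> \<mu> \<mu>'"
      "\<And>q'. angel_move \<mu>' q q' \<Longrightarrow> devil_wins_within \<sigma> n \<mu>' q'"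
    by auto
  then show ?case
    using Suc.IH by (subst devil_wins_within.simps(2)) blast
qed simp

lemma devil_wins_within_mono:
  "m \<le> n \<Longrightarrow> devil_wins_within \<sigma> m \<mu> q \<Longrightarrow> devil_wins_within \<sigma> n \<mu> q"
  by (induction rule: dec_induct) (auto simp del: devil_wins_within.simps intro: devil_wins_within_Suc)

definition angel_safe :: "real \<Rightarrow> weighting \<Rightarrow> square \<Rightarrow> bool" where
  "angel_safe \<sigma> \<mu> q \<longleftrightarrow> (\<forall>n. \<not> devil_wins_within \<sigma> n \<mu> q)"

text \<open>The angel has only finitely many replies, so the ranks of losing replies are bounded.\<close>

lemma angel_safe_step:
  assumes "angel_safe \<sigma> \<mu> q" and "devil_move \<sigma> \<mu> \<mu>'"
  shows "\<exists>q'. angel_move \<mu>' q q' \<and> angel_safe \<sigma> \<mu>' q'"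
proof (rule ccontr)
  assume "\<not> ?thesis"
  then have "\<forall>q'. \<exists>n. angel_move \<mu>' q q' \<longrightarrow> devil_wins_within \<sigma> n \<mu>' q'"
    by (auto simp: angel_safe_def)
  then obtain r where r: "\<And>q'. angel_move \<mu>' q q' \<Longrightarrow> devil_wins_within \<sigma> (r q') \<mu>' q'"
    by metis
  define N where "N = Max (r ` {q'. near q q'})"
  have "devil_wins_within \<sigma> N \<mu>' q'" if "angel_move \<mu>' q q'" for q'
  proof (rule devil_wins_within_mono[OF _ r[OF that]])
    show "r q' \<le> N"
      unfolding N_def using that finite_near by (intro Max_ge) (auto simp: angel_move_iff)
  qed
  with assms(2) have "devil_wins_within \<sigma> (Suc N) \<mu> q"
    by auto
  with assms(1) show False
    unfolding angel_safe_def by blast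
qed

lemma angel_safe_imp_winning_strategy:
  assumes "angel_safe \<sigma> (\<lambda>_. 0) p"
  shows "\<exists>s. winning_strategy \<sigma> p s"
proof -
  define nxt where "nxt q \<mu> = (SOME q'. angel_move \<mu> q q' \<and> angel_safe \<sigma> \<mu> q')" for q \<mu>
  have nxt: "angel_move \<mu>' q (nxt q \<mu>') \<and> angel_safe \<sigma> \<mu>' (nxt q \<mu>')"
    if "angel_safe \<sigma> \<mu> q" "devil_move \<sigma> \<mu> \<mu>'" for \<mu> \<mu>' q
    unfolding nxt_def using someI_ex[OF angel_safe_step[OF that]] .
  \<comment> \<open>\<open>tl\<close> drops \<open>\<mu> 0\<close>, which precedes the devil's first
    move and gets no reply.\<close>
  define s where "s ms = foldl nxt p (tl ms)" for ms
  have pos: "angel_pos p s \<mu> (Suc t) = nxt (angel_pos p s \<mu> t) (\<mu> (Suc t))" for \<mu> t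
  proof (cases t)
    case (Suc k)
    have tl: "tl (map \<mu> [0..<n]) = map \<mu> [Suc 0..<n]" for n
      by (metis map_tl tl_upt)
    show ?thesis
      unfolding Suc angel_pos.simps s_def tl by simp
  qed (simp add: s_def)
  have "angel_safe \<sigma> (\<mu> t) (angel_pos p s \<mu> t)" if "devil_play \<sigma> \<mu>" for \<mu> t
  proof (induction t)
    case 0
    show ?case
      using assms that by (simp add: devil_play_def)
  next
    case (Suc t)
    then show ?case
      using nxt that unfolding pos devil_play_def by blast
  qed
  then have "winning_strategy \<sigma> p s"
    unfolding winning_strategy_def pos using nxt unfolding devil_play_def by meson
  then show ?thesis
    by blast
qed

section \<open>The left-hand rule\<close>

text \<open>A walker at \<open>(x, y)\<close> facing \<open>(a, b)\<close>; her left is \<open>(-b, a)\<close>, and \<open>B\<close> is the set of walls.\<close>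

fun walk :: "(square \<Rightarrow> bool) \<Rightarrow> square \<times> square \<Rightarrow> square \<times> square" where
  "walk B ((x, y), (a, b)) =
     (if \<not> B (x - b, y + a) then ((x - b, y + a), (- b, a))
      else if \<not> B (x + a, y + b) then ((x + a, y + b), (a, b))
      else ((x, y), (b, - a)))"

text \<open>The second alternative arises when a step ahead passes the end of the wall: the wall is
  then diagonally behind on the left, and the square just left is free.\<close>

fun along_wall :: "(square \<Rightarrow> bool) \<Rightarrow> square \<times> square \<Rightarrow> bool" where
  "along_wall B ((x, y), (a, b)) \<longleftrightarrow>
     \<bar>a\<bar> + \<bar>b\<bar> = 1 \<and> \<not> B (x, y) \<and>
     (B (x - b, y + a) \<or> \<not> B (x - a, y - b) \<and> B (x - b - a, y + a - b))"

lemma along_wall_walk: "along_wall B s \<Longrightarrow> along_wall B (walk B s)"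
  by (cases "(B, s)" rule: walk.cases) (auto simp: algebra_simps)

lemma near_walk: "along_wall B s \<Longrightarrow> near (fst s) (fst (walk C s))"
  by (cases "(B, s)" rule: walk.cases) (auto simp: near_def)

lemma walk_cong:
  assumes "along_wall B s" and "\<And>x. near (fst s) x \<Longrightarrow> B x = C x"
  shows "walk B s = walk C s"
proof -
  obtain x y a b where s: "s = ((x, y), (a, b))"
    by (metis surj_pair)
  then have "\<bar>a\<bar> + \<bar>b\<bar> = 1"
    using assms(1) by simp
  then have "B (x - b, y + a) = C (x - b, y + a)" "B (x + a, y + b) = C (x + a, y + b)"
    by (simp_all add: assms(2) near_def s)
  then show ?thesis
    using s by simp
qed

text \<open>The walls reveal the last move: a right turn if the square behind is blocked; otherwise
  a step ahead if the left rear square is blocked, and a left turn if it is free.\<close>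

lemma walk_inj:
  assumes "along_wall B s" "along_wall B s'" "walk B s = walk B s'"
  shows "s = s'"
proof -
  obtain x y a b x' y' a' b' where s: "s = ((x, y), (a, b))" "s' = ((x', y'), (a', b'))"
    by (metis surj_pair)
  show "s = s'"
    using assms unfolding s by (auto split: if_splits simp: algebra_simps)
qed

text \<open>Against the wall \<open>fst x < w\<close> alone the walker goes steadily north; any other step is
  caused by one of at most three blocked squares beyond that wall.\<close>

lemma walk_not_north:
  assumes "along_wall B ((x, y), (a, b))" and wall: "\<And>z. fst z < w \<Longrightarrow> B z"
    and "snd (fst (walk B ((x, y), (a, b)))) \<noteq> y + 1"
  shows "\<exists>z \<in> {(x - b, y + a), (x - b - a, y + a - b), (x + a, y + b)}.
           B z \<and> w \<le> fst z \<and>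
           (near (x, y) z \<or> near (fst (walk B ((x, y), (a, b)))) z)"
proof -
  have w: "B (u, v) \<or> w \<le> u" for u v
    using wall[of "(u, v)"] by auto
  have "\<bar>a\<bar> + \<bar>b\<bar> = 1"
    using assms(1) by simp
  then consider "a = 1" "b = 0" | "a = -1" "b = 0" | "a = 0" "b = 1" | "a = 0" "b = -1"
    by linarith
  \<comment> \<open>Only when she faces north can the wall on her left be the western one. Then the
    culprit is the square ahead or, if she turns west, the square diagonally behind on the
    left.\<close>
  then show ?thesis
    using assms(1,3) w[of x y] w[of "x - a" "y - b"] w[of "x - b" "y + a"] w[of "x + a" "y + b"]
    by cases (auto simp: near_def split: if_splits)
qed

section \<open>A devil who forgets detours\<close>

text \<open>\<open>L\<close> holds of positions lost for the angel, with rank \<open>\<rho>\<close>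
  and winning replies \<open>D\<close>. Legality of \<open>D\<close> extends beyond \<open>L\<close>
  because \<open>resp\<close> is formed along arbitrary paths.\<close>

locale devil_wins =
  fixes \<sigma> :: real and D :: "weighting \<Rightarrow> square \<Rightarrow> weighting"
    and L :: "weighting \<Rightarrow> square \<Rightarrow> bool" and \<rho> :: "weighting \<Rightarrow> square \<Rightarrow> nat" and p :: square
  assumes devil_move_D: "\<mu> summable_on UNIV \<Longrightarrow> devil_move \<sigma> \<mu> (D \<mu> q)"
    and L_start: "L (\<lambda>_. 0) p"
    and L_step: "L \<mu> q \<Longrightarrow> angel_move (D \<mu> q) q q' \<Longrightarrow> L (D \<mu> q) q' \<and> \<rho> (D \<mu> q) q' < \<rho> \<mu> q"
begin

definition reach :: "(nat \<Rightarrow> square) \<Rightarrow> square \<Rightarrow> nat" where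
  "reach u x = (LEAST i. near (u i) x)"

lemma reach_le: "near (u i) x \<Longrightarrow> reach u x \<le> i"
  unfolding reach_def by (rule Least_le)

lemma near_reach: "near (u i) x \<Longrightarrow> near (u (reach u x)) x"
  unfolding reach_def by (rule LeastI)

lemma reach_cong:
  assumes "\<And>i. i \<le> n \<Longrightarrow> u i = v i" and "near (u n) x"
  shows "reach u x = reach v x"
proof (rule antisym)
  have v: "near (v n) x"
    using assms by simp
  have "near (u (reach v x)) x"
    using near_reach[of v n x, OF v] reach_le[of v n x, OF v] assms(1) by simp
  then show "reach u x \<le> reach v x"
    by (rule reach_le)
  have "near (v (reach u x)) x"
    using near_reach[of u n x, OF assms(2)] reach_le[of u n x, OF assms(2)] assms(1) by simp
  then show "reach v x \<le> reach u x"
    by (rule reach_le)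
qed

text \<open>Shortcut the path \<open>u\<close> by letting the earliest position from which \<open>u n\<close> was within reach be
  the predecessor of \<open>u n\<close>. Then \<open>resp u n\<close> is the reply of \<open>D\<close> to the shortcut path to \<open>u n\<close>.\<close>

function resp :: "(nat \<Rightarrow> square) \<Rightarrow> nat \<Rightarrow> weighting" where
  "resp u n = D (if reach u (u n) < n then resp u (reach u (u n)) else (\<lambda>_. 0)) (u n)"
  by auto
termination by (relation "measure snd") auto

declare resp.simps [simp del]

text \<open>On a path of single steps the guard fails only at time 0, where the shortcut play
  starts.\<close>

definition prior :: "(nat \<Rightarrow> square) \<Rightarrow> nat \<Rightarrow> weighting" where
  "prior u n = (if reach u (u n) < n then resp u (reach u (u n)) else (\<lambda>_. 0))"

definition incr :: "(nat \<Rightarrow> square) \<Rightarrow> nat \<Rightarrow> weighting" where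
  "incr u n x = resp u n x - prior u n x"

text \<open>This collects the increments of all shortcut branches, so it grows with time, by total
  weight at most \<open>\<sigma>\<close> per step.\<close>

definition cum :: "(nat \<Rightarrow> square) \<Rightarrow> nat \<Rightarrow> weighting" where
  "cum u n x = (\<Sum>i\<le>n. incr u i x)"

lemma resp_eq: "resp u n = D (prior u n) (u n)"
  unfolding prior_def by (rule resp.simps)

lemma resp_cong:
  "(\<And>i. i \<le> n \<Longrightarrow> u i = v i) \<Longrightarrow> resp u n = resp v n"
proof (induction n rule: less_induct)
  case (less n)
  have "reach u (u n) = reach v (v n)"
    using reach_cong[of n u v "u n"] less.prems by simp
  then show ?case
    using less by (simp add: resp.simps[of _ n])
qed

lemma prior_cong:
  "(\<And>i. i \<le> n \<Longrightarrow> u i = v i) \<Longrightarrow> prior u n = prior v n"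
  using reach_cong[of n u v "u n"] resp_cong[of "reach u (u n)" u v] by (auto simp: prior_def)

lemma cum_cong:
  "(\<And>i. i \<le> n \<Longrightarrow> u i = v i) \<Longrightarrow> cum u n = cum v n"
  unfolding cum_def incr_def
  by (intro ext sum.cong refl arg_cong2[where f = "(-)"])
     (metis atMost_iff order_trans resp_cong, metis atMost_iff order_trans prior_cong)

lemma summable_prior: "prior u n summable_on UNIV"
proof (induction n rule: less_induct)
  case (less n)
  show ?case
  proof (cases "reach u (u n) < n")
    case True
    then have "devil_move \<sigma> (prior u (reach u (u n))) (prior u n)"
      using devil_move_D[OF less[OF True]] by (simp add: prior_def[of u n] resp_eq)
    then show ?thesis
      by (simp add: devil_move_def)
  qed (simp add: prior_def)
qed

lemma devil_move_resp: "devil_move \<sigma> (prior u n) (resp u n)"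
  unfolding resp_eq by (rule devil_move_D[OF summable_prior])

lemma incr_nonneg: "0 \<le> incr u n x"
  using devil_move_resp[of u n] by (simp add: devil_move_def incr_def del: split_paired_All)

lemma sum_incr_le:
  assumes "finite A"
  shows "(\<Sum>x\<in>A. incr u n x) \<le> \<sigma>"
proof -
  note m = devil_move_resp[of u n, unfolded devil_move_def total_weight_def]
  have "((\<lambda>x. resp u n x + - prior u n x) has_sum
      (infsum (resp u n) UNIV + - infsum (prior u n) UNIV)) UNIV"
    using m summable_prior by (intro has_sum_add) (auto simp: has_sum_uminus intro: has_sum_infsum)
  then have "(incr u n has_sum (infsum (resp u n) UNIV - infsum (prior u n) UNIV)) UNIV"
    by (simp add: incr_def[abs_def])
  then have "sum (incr u n) A \<le> infsum (resp u n) UNIV - infsum (prior u n) UNIV"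
    using assms incr_nonneg by (intro finite_sum_le_has_sum) auto
  then show ?thesis
    using m by linarith
qed

lemma cum_mono: "m \<le> n \<Longrightarrow> cum u m x \<le> cum u n x"
  unfolding cum_def by (rule sum_mono2) (auto simp: incr_nonneg)

text \<open>The ancestors of \<open>n\<close> on the shortcut path are distinct times up to \<open>n\<close>.\<close>

lemma resp_le_cum: "resp u n x \<le> cum u n x"
proof (induction n rule: less_induct)
  case (less n)
  have eq: "resp u n x = prior u n x + incr u n x"
    by (simp add: incr_def)
  show ?case
  proof (cases "reach u (u n) < n")
    case True
    then obtain k where k: "n = Suc k" "reach u (u n) \<le> k"
      by (cases n) auto
    have "prior u n x \<le> cum u (reach u (u n)) x"
      using less[OF True] True by (simp add: prior_def)
    also have "\<dots> \<le> cum u k x"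
      by (rule cum_mono[OF k(2)])
    finally show ?thesis
      using eq by (simp add: k(1) cum_def)
  next
    case False
    have "incr u n x \<le> cum u n x"
      unfolding cum_def by (rule member_le_sum) (auto simp: incr_nonneg)
    then show ?thesis
      using eq False by (simp add: prior_def)
  qed
qed

text \<open>Each shortcut edge is legal, as \<open>cum\<close> dominates the weight on its branch.
  It lowers the rank by at least one and changes the height by at most one.\<close>

lemma shortcut_bounded:
  assumes "u 0 = p" and near: "\<And>n. near (u n) (u (Suc n))"
    and light: "\<And>n. cum u (reach u (u n)) (u n) < 1"
  shows "L (prior u n) (u n) \<and> \<bar>snd (u n) - snd p\<bar> + int (\<rho> (prior u n) (u n)) \<le> int (\<rho> (\<lambda>_. 0) p)"
proof (induction n rule: less_induct)
  case (less n)
  show ?case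
  proof (cases n)
    case 0
    then show ?thesis
      using L_start assms(1) by (simp add: prior_def)
  next
    case (Suc k)
    let ?i = "reach u (u n)"
    have i: "?i < n"
      using reach_le[of u k "u n"] near[of k] Suc by simp
    have nr: "near (u ?i) (u n)"
      by (rule near_reach[of u n]) simp
    have "angel_move (resp u ?i) (u ?i) (u n)"
      using nr light[of n] resp_le_cum[of u ?i "u n"] by (simp add: angel_move_iff)
    moreover have "prior u n = resp u ?i"
      using i by (simp add: prior_def)
    ultimately have "L (prior u n) (u n)" "\<rho> (prior u n) (u n) < \<rho> (prior u ?i) (u ?i)"
      using L_step[of "prior u ?i" "u ?i" "u n"] less[OF i] by (auto simp: resp_eq)
    then show ?thesis
      using less[OF i] nr by (auto simp: near_def)
  qed
qed

definition heavy :: "(nat \<Rightarrow> square) \<Rightarrow> square \<Rightarrow> bool" where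
  "heavy u x \<longleftrightarrow> (\<exists>i. near (u i) x) \<and> 1 \<le> cum u (reach u x) x"

lemma card_heavy:
  fixes u m
  defines "H \<equiv> {x. heavy u x \<and> (\<exists>i\<le>m. near (u i) x)}"
  shows "finite H" and "real (card H) \<le> real (Suc m) * \<sigma>"
proof -
  have "H \<subseteq> (\<Union>i\<in>{..m}. {x. near (u i) x})"
    by (auto simp: H_def)
  then show fin: "finite H"
    by (rule finite_subset) (auto intro: finite_near)
  have "1 \<le> cum u m x" if "x \<in> H" for x
  proof -
    obtain i where "i \<le> m" "near (u i) x" "1 \<le> cum u (reach u x) x"
      using \<open>x \<in> H\<close> by (auto simp: H_def heavy_def)
    then show ?thesis
      using cum_mono[of "reach u x" m u x] reach_le[of u i x] by simp
  qed
  then have "real (card H) \<le> (\<Sum>x\<in>H. cum u m x)"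
    using sum_mono[of H "\<lambda>_. 1" "cum u m"] by simp
  also have "\<dots> = (\<Sum>i\<le>m. \<Sum>x\<in>H. incr u i x)"
    unfolding cum_def by (rule sum.swap)
  also have "\<dots> \<le> (\<Sum>i\<le>m. \<sigma>)"
    by (intro sum_mono sum_incr_le fin)
  finally show "real (card H) \<le> real (Suc m) * \<sigma>"
    by simp
qed

section \<open>The runner\<close>

definition blocked :: "(nat \<Rightarrow> square) \<Rightarrow> square \<Rightarrow> bool" where
  "blocked u x \<longleftrightarrow> fst x < fst p \<or> heavy u x"

text \<open>The walls depend on the path itself, so the path is built in stages; entries after
  \<open>n\<close> are placeholders.\<close>

primrec hist :: "nat \<Rightarrow> nat \<Rightarrow> square \<times> square" where
  "hist 0 = (\<lambda>_. (p, (0, 1)))"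
| "hist (Suc n) = (hist n)(Suc n := walk (blocked (fst \<circ> hist n)) (hist n n))"

definition run :: "nat \<Rightarrow> square \<times> square" where
  "run n = hist n n"

abbreviation pos :: "nat \<Rightarrow> square" where
  "pos \<equiv> fst \<circ> run"

lemma hist_eq_run: "i \<le> n \<Longrightarrow> hist n i = run i"
  by (induction n) (auto simp: run_def le_Suc_eq)

text \<open>A square near the current position was first within reach by now, so its frozen weight
  depends only on the path so far.\<close>

lemma blocked_hist:
  assumes "near (pos n) x"
  shows "blocked (fst \<circ> hist n) x = blocked pos x"
proof -
  have eq: "(fst \<circ> hist n) i = pos i" if "i \<le> n" for i
    using hist_eq_run[OF that] by simp
  have near: "near ((fst \<circ> hist n) n) x"
    using assms eq by simp
  have r: "reach (fst \<circ> hist n) x = reach pos x"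
    by (rule reach_cong[where n = n]) (use eq near in auto)
  have "reach pos x \<le> n"
    using assms by (rule reach_le)
  then have "cum (fst \<circ> hist n) (reach pos x) = cum pos (reach pos x)"
    by (intro cum_cong eq) simp
  then show ?thesis
    unfolding blocked_def heavy_def r using assms near by auto
qed

end

text \<open>Twelve states per heavy square, each costing two units of height, lose at most
  \<open>24 * \<sigma> * (m + 1)\<close>, which is below \<open>m / 2\<close> for positive
  \<open>m\<close>.\<close>

locale devil_wins_slowly = devil_wins +
  assumes \<sigma>_less: "\<sigma> < 1 / 96"
begin

lemma not_blocked_start: "\<not> blocked pos p"
proof -
  have "pos 0 = p"
    by (simp add: run_def)
  then have "reach pos p = 0"
    using reach_le[of pos 0 p] by simp
  moreover have "cum pos 0 p < 1"
    using sum_incr_le[of "{p}" pos 0] \<sigma>_less by (simp add: cum_def)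
  ultimately show ?thesis
    by (simp add: blocked_def heavy_def)
qed

lemma run_Suc_if_along_wall:
  assumes "along_wall (blocked pos) (run n)"
  shows "run (Suc n) = walk (blocked pos) (run n)"
proof -
  have "run (Suc n) = walk (blocked (fst \<circ> hist n)) (run n)"
    by (simp add: run_def)
  also have "\<dots> = walk (blocked pos) (run n)"
    using assms by (intro walk_cong[symmetric]) (simp_all add: blocked_hist)
  finally show ?thesis .
qed

lemma along_wall_run: "along_wall (blocked pos) (run n)"
proof (induction n)
  case 0
  have "run 0 = ((fst p, snd p), (0, 1))"
    by (simp add: run_def)
  moreover have "blocked pos (fst p - 1, snd p)"
    by (simp add: blocked_def)
  ultimately show ?case
    using not_blocked_start by (simp only: along_wall.simps) simp
next
  case (Suc n)
  then show ?case
    unfolding run_Suc_if_along_wall[OF Suc.IH] by (rule along_wall_walk)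
qed

lemmas run_Suc = run_Suc_if_along_wall[OF along_wall_run]

lemma near_run: "near (pos n) (pos (Suc n))"
  using near_walk[OF along_wall_run[of n]] by (simp add: run_Suc)

text \<open>A state in which the runner does not go north is charged to a heavy square; each heavy square
  is charged by at most twelve states.\<close>

lemma card_not_north:
  assumes inj: "inj_on run {..<m}"
  shows "real (card {n. n < m \<and> snd (pos (Suc n)) \<noteq> snd (pos n) + 1}) \<le> 12 * real (Suc m) * \<sigma>"
proof -
  define Bad where "Bad = {n. n < m \<and> snd (pos (Suc n)) \<noteq> snd (pos n) + 1}"
  define H where "H = {x. heavy pos x \<and> (\<exists>i\<le>m. near (pos i) x)}"
  define dirs where "dirs = {(1, 0), (-1, 0), (0, 1), (0 :: int, -1 :: int)}"
  \<comment> \<open>\<open>g\<close> recovers the state from the charged square, the facing and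
    which of the three relative places the square occupies: 4 times 3 choices.\<close>
  define g :: "square \<times> square \<times> nat \<Rightarrow> square \<times> square" where "g = (\<lambda>((x, y), (a, b), k).
    (if k = 0 then (x + b, y - a) else if k = 1 then (x + b + a, y - a + b) else (x - a, y - b),
     (a, b)))"
  have fin: "finite H" and H: "real (card H) \<le> real (Suc m) * \<sigma>"
    using card_heavy[of pos m] by (simp_all add: H_def)
  have "run ` Bad \<subseteq> g ` (H \<times> dirs \<times> {0, 1, 2})"
  proof
    fix s assume "s \<in> run ` Bad"
    then obtain n where n: "n < m" "s = run n" "snd (pos (Suc n)) \<noteq> snd (pos n) + 1"
      by (auto simp: Bad_def)
    obtain x y a b where s: "run n = ((x, y), (a, b))"
      by (metis surj_pair)
    have al: "along_wall (blocked pos) ((x, y), (a, b))"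
      using along_wall_run[of n] by (simp add: s)
    obtain z where z: "z \<in> {(x - b, y + a), (x - b - a, y + a - b), (x + a, y + b)}"
        "blocked pos z" "fst p \<le> fst z"
        "near (x, y) z \<or> near (fst (walk (blocked pos) ((x, y), (a, b)))) z"
    proof -
      have "snd (fst (walk (blocked pos) ((x, y), (a, b)))) \<noteq> y + 1"
        using n(3) by (simp add: run_Suc s del: walk.simps)
      then show ?thesis
        using walk_not_north[OF al, of "fst p"] that unfolding Bex_def
        by (simp only: blocked_def) blast
    qed
    have "near (pos n) z \<or> near (pos (Suc n)) z"
      using z(4) by (simp add: run_Suc s del: walk.simps)
    then have "\<exists>i\<le>m. near (pos i) z"
      using less_imp_le[OF n(1)] Suc_leI[OF n(1)] by blast
    then have "z \<in> H"
      using z(2,3) by (simp add: H_def blocked_def)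
    moreover have "\<bar>a\<bar> + \<bar>b\<bar> = 1"
      using al by simp
    then have "(a, b) \<in> dirs"
      unfolding dirs_def by (simp; linarith)
    moreover obtain k where "k \<in> {0, 1, 2}" "((x, y), (a, b)) = g (z, (a, b), k)"
    proof -
      have "((x, y), (a, b)) \<in> (\<lambda>k. g (z, (a, b), k)) ` {0, 1, 2}"
        using z(1) by (auto simp: g_def)
      then show ?thesis
        using that by blast
    qed
    ultimately show "s \<in> g ` (H \<times> dirs \<times> {0, 1, 2})"
      unfolding n(2) s by (intro image_eqI[where x = "(z, (a, b), k)"]) simp_all
  qed
  then have "card (run ` Bad) \<le> card (g ` (H \<times> dirs \<times> {0, 1, 2}))"
    using fin by (intro card_mono) (auto simp: dirs_def)
  also have "\<dots> \<le> card (H \<times> dirs \<times> {0, 1, 2 :: nat})"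
    using fin by (intro card_image_le) (auto simp: dirs_def)
  also have "\<dots> = 12 * card H"
    by (simp add: card_cartesian_product dirs_def)
  finally have "card Bad \<le> 12 * card H"
    using inj by (subst (asm) card_image) (auto simp: Bad_def intro: inj_on_subset)
  then show ?thesis
    using H unfolding Bad_def by linarith
qed

lemma run_goes_north:
  assumes inj: "inj_on run {..<m}" and "0 < m"
  shows "real m / 2 < real_of_int (snd (pos m) - snd p)"
proof -
  define Bad where "Bad = {n. n < m \<and> snd (pos (Suc n)) \<noteq> snd (pos n) + 1}"
  have "snd (pos m) - snd p = (\<Sum>n<m. snd (pos (Suc n)) - snd (pos n))"
    using sum_lessThan_telescope[of "\<lambda>n. snd (pos n)" m] by (simp add: run_def)
  also have "\<dots> \<ge> (\<Sum>n<m. 1 - 2 * of_bool (n \<in> Bad))"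
  proof (rule sum_mono)
    fix n assume "n \<in> {..<m}"
    then show "1 - 2 * of_bool (n \<in> Bad) \<le> snd (pos (Suc n)) - snd (pos n)"
      using near_run[of n] by (auto simp: Bad_def near_def)
  qed
  also have "(\<Sum>n<m. 1 - 2 * of_bool (n \<in> Bad)) = int m - 2 * int (card Bad)"
  proof -
    have "{..<m} \<inter> Bad = Bad"
      by (auto simp: Bad_def)
    then show ?thesis
      by (simp add: sum_subtractf sum_distrib_left[symmetric])
  qed
  finally have "real m - 2 * real (card Bad) \<le> real_of_int (snd (pos m) - snd p)"
    by linarith
  moreover have "2 * real (card Bad) < real m / 2"
  proof -
    have "2 * real (card Bad) \<le> 24 * (real (Suc m) * \<sigma>)"
      using card_not_north[OF inj] unfolding Bad_def by (simp add: algebra_simps)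
    also have "\<dots> < 24 * (real (Suc m) * (1 / 96))"
      using \<sigma>_less by (intro mult_strict_left_mono) auto
    also have "\<dots> \<le> real m / 2"
      using \<open>0 < m\<close> by simp
    finally show ?thesis .
  qed
  ultimately show ?thesis
    by linarith
qed

text \<open>Since the walk is reversible, the first repeated state would be the initial one.\<close>

lemma inj_run: "inj_on run {..<m}"
proof (induction m)
  case (Suc m)
  have "run m \<noteq> run j" if "j < m" for j
  proof (cases j)
    case 0
    have "real m / 2 < real_of_int (snd (pos m) - snd p)"
      using that by (intro run_goes_north[OF Suc]) simp
    then show ?thesis
      using 0 by (auto simp: run_def)
  next
    case (Suc i)
    obtain k where k: "m = Suc k"
      using \<open>j < m\<close> by (cases m) auto
    have "run k \<noteq> run i"
      using inj_onD[OF Suc.IH, of k i] that \<open>j = Suc i\<close> k by auto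
    then show ?thesis
      using walk_inj[OF along_wall_run along_wall_run, of k i] by (auto simp: k Suc run_Suc)
  qed
  then show ?case
    using Suc by (auto simp: lessThan_Suc)
qed simp

lemma contradiction: False
proof -
  have "cum pos (reach pos (pos n)) (pos n) < 1" for n
  proof -
    obtain x y a b where s: "run n = ((x, y), (a, b))"
      by (metis surj_pair)
    have "\<not> blocked pos (pos n)"
      using along_wall_run[of n] by (simp add: s)
    then show ?thesis
      by (auto simp: blocked_def heavy_def not_le intro: near_refl)
  qed
  then have bound: "\<bar>snd (pos n) - snd p\<bar> \<le> int (\<rho> (\<lambda>_. 0) p)" for n
    using shortcut_bounded[of pos n] near_run by (auto simp: run_def)
  define m where "m = 2 * \<rho> (\<lambda>_. 0) p + 1"
  have "real m / 2 < real_of_int (snd (pos m) - snd p)"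
    by (rule run_goes_north[OF inj_run]) (simp add: m_def)
  also have "\<dots> \<le> real (\<rho> (\<lambda>_. 0) p)"
    using bound[of m] by linarith
  finally show False
    by (simp add: m_def)
qed

end

theorem theorem1p2:
  "\<exists>\<sigma>\<^sub>0>0. \<forall>\<sigma>::real. 0 < \<sigma> \<and> \<sigma> < \<sigma>\<^sub>0 \<longrightarrow>
     (\<forall>p::square. \<exists>s::strategy. winning_strategy \<sigma> p s)"
proof (intro exI[of _ "1 / 96"] conjI allI impI)
  fix \<sigma> :: real and p :: square
  assume \<sigma>: "0 < \<sigma> \<and> \<sigma> < 1 / 96"
  have "angel_safe \<sigma> (\<lambda>_. 0) p"
  proof (rule ccontr)
    assume unsafe: "\<not> angel_safe \<sigma> (\<lambda>_. 0) p"
    define \<rho> where "\<rho> \<mu> q = (LEAST n. devil_wins_within \<sigma> n \<mu> q)" for \<mu> q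
    let ?good = "\<lambda>\<mu> q \<mu>'. devil_move \<sigma> \<mu> \<mu>' \<and>
      (\<forall>q'. angel_move \<mu>' q q' \<longrightarrow> \<not> angel_safe \<sigma> \<mu>' q' \<and> \<rho> \<mu>' q' < \<rho> \<mu> q)"
    have ex: "\<exists>\<mu>'. ?good \<mu> q \<mu>'" if "\<not> angel_safe \<sigma> \<mu> q" for \<mu> q
    proof -
      have "devil_wins_within \<sigma> (\<rho> \<mu> q) \<mu> q"
        using that unfolding angel_safe_def \<rho>_def by (auto intro: LeastI)
      then obtain n where n: "\<rho> \<mu> q = Suc n" "devil_wins_within \<sigma> (Suc n) \<mu> q"
        by (cases "\<rho> \<mu> q") auto
      then obtain \<mu>' where "devil_move \<sigma> \<mu> \<mu>'"
          and w: "\<And>q'. angel_move \<mu>' q q' \<Longrightarrow> devil_wins_within \<sigma> n \<mu>' q'"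
        by auto
      moreover have "\<rho> \<mu>' q' < \<rho> \<mu> q" if "angel_move \<mu>' q q'" for q'
        using Least_le[of "\<lambda>n. devil_wins_within \<sigma> n \<mu>' q'", OF w[OF that]]
        by (simp add: n(1)) (simp add: \<rho>_def)
      ultimately show ?thesis
        unfolding angel_safe_def by blast
    qed
    \<comment> \<open>Leaving the weights unchanged is a legal default since \<open>\<sigma>\<close>
      is positive.\<close>
    define D where "D \<mu> q = (if angel_safe \<sigma> \<mu> q then \<mu> else SOME \<mu>'. ?good \<mu> q \<mu>')" for \<mu> q
    have D: "?good \<mu> q (D \<mu> q)" if "\<not> angel_safe \<sigma> \<mu> q" for \<mu> q
      using someI_ex[OF ex[OF that]] that by (simp add: D_def)
    interpret devil_wins_slowly \<sigma> D "\<lambda>\<mu> q. \<not> angel_safe \<sigma> \<mu> q" \<rho> p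
    proof
      show "devil_move \<sigma> \<mu> (D \<mu> q)" if "\<mu> summable_on UNIV" for \<mu> q
      proof (cases "angel_safe \<sigma> \<mu> q")
        case True
        then show ?thesis
          using that \<sigma> by (simp add: D_def devil_move_def)
      qed (use D in blast)
    qed (use D unsafe \<sigma> in auto)
    show False
      by (rule contradiction)
  qed
  then show "\<exists>s. winning_strategy \<sigma> p s"
    by (rule angel_safe_imp_winning_strategy)
qed simp

end
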